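(* For every $\epsilon > 0$ there is some $n_0 = n_0(\epsilon)$ such that for every $n > n_0$, every proper edge coloring of the complete graph $K_n$ contains a rainbow path on at least $(3/4 - \epsilon)n$ vertices.
   Context: A proper edge coloring of a graph $G=(V,E)$ is a map $c\colon E\to \mathbb{N}$ such that any two distinct edges sharing an endpoint receive different colors. A subgraph (e.g. a path) is rainbow if no two of its edges receive the same color. *)

theory Defs
  imports Complex_Main "HOL-Library.Ramsey"
begin

text \<open>A finite simple graph is given by a vertex set \<open>V\<close> and a set \<open>E\<close> of two-element
  subsets of \<open>V\<close>. An edge coloring is a total function on sets of which only the values on \<open>E\<close>
  are ever used.\<close>

definition complete_graph_edges :: "nat \<Rightarrow> nat set set" where
  "complete_graph_edges n = [{..<n}]\<^bsup>2\<^esup>"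

definition proper_edge_coloring :: "'a set set \<Rightarrow> ('a set \<Rightarrow> nat) \<Rightarrow> bool" where
  "proper_edge_coloring E c \<longleftrightarrow>
     (\<forall>e\<in>E. \<forall>f\<in>E. e \<noteq> f \<and> e \<inter> f \<noteq> {} \<longrightarrow> c e \<noteq> c f)"

text \<open>A path is the nonempty list of its vertices in order, so its number of vertices is the
  length of the list.\<close>

definition path_edges :: "'a list \<Rightarrow> 'a set set" where
  "path_edges p = {{p ! i, p ! Suc i} | i. Suc i < length p}"

definition is_path :: "'a set \<Rightarrow> 'a set set \<Rightarrow> 'a list \<Rightarrow> bool" where
  "is_path V E p \<longleftrightarrow> p \<noteq> [] \<and> distinct p \<and> set p \<subseteq> V \<and> path_edges p \<subseteq> E"

definition rainbow :: "('a set \<Rightarrow> nat) \<Rightarrow> 'a set set \<Rightarrow> bool" where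
  "rainbow c F \<longleftrightarrow> inj_on c F"

end

theory Submission
  imports Defs "HOL-Real_Asymp.Real_Asymp"
begin

text \<open>The proof gives a rainbow path on \<open>(1 - \<epsilon>) n\<close> vertices, following the strategy of Alon, Pokrovskiy and
  Sudakov. Splitting the colors at random into \<open>k\<close> classes makes every class \<^emph>\<open>expanding\<close>: it
  joins any two disjoint vertex sets of moderate size. Reserve the class \<open>K\<close> with the fewest edges and
  a small vertex set \<open>R\<close>. Among the rainbow linear forests with \<open>q\<close> paths that avoid \<open>R\<close> and \<open>K\<close>, take
  a largest one. If it missed many vertices, then each initial vertex \<open>x\<^sub>t\<close> of a path would have so
  many edges in free colors that redirecting \<open>z \<rightarrow> \<sigma> z\<close> to \<open>z \<rightarrow> x\<^sub>t\<close> frees, for each further \<open>t\<close>, linearly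
  many new colors, until more colors are freed than exist. Finally the boundedly many paths are
  concatenated through connections \<open>y \<rightarrow> a \<rightarrow> b \<rightarrow> x\<close> with \<open>a, b \<in> R\<close> and all three colors in \<open>K\<close>.\<close>

section \<open>Linear forests\<close>

text \<open>Each path is directed, \<open>E\<close> being its successor relation; the number of paths, trivial ones
  included, is \<open>card W - card E\<close>.\<close>

definition linear_forest :: "'a set \<Rightarrow> ('a \<times> 'a) set \<Rightarrow> bool" where
  "linear_forest W E \<longleftrightarrow>
     finite W \<and> E \<subseteq> W \<times> W \<and> single_valued E \<and> single_valued (E\<inverse>) \<and> acyclic E"

lemma linear_forest_finite: "linear_forest W E \<Longrightarrow> finite E"
  unfolding linear_forest_def by (meson finite_SigmaI finite_subset)

lemma linear_forest_fun: "linear_forest W E \<Longrightarrow> (a, b) \<in> E \<Longrightarrow> (a, b') \<in> E \<Longrightarrow> b = b'"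
  unfolding linear_forest_def single_valued_def by blast

lemma linear_forest_inj: "linear_forest W E \<Longrightarrow> (a, b) \<in> E \<Longrightarrow> (a', b) \<in> E \<Longrightarrow> a = a'"
  unfolding linear_forest_def single_valued_def by blast

lemma linear_forest_subset: "linear_forest W E \<Longrightarrow> F \<subseteq> E \<Longrightarrow> linear_forest W F"
  unfolding linear_forest_def by (meson acyclic_subset converse_mono single_valued_subset subset_trans)

lemma linear_forest_superset: "linear_forest W E \<Longrightarrow> finite W' \<Longrightarrow> W \<subseteq> W' \<Longrightarrow> linear_forest W' E"
  unfolding linear_forest_def by blast

lemma linear_forest_insert:
  assumes "linear_forest W E" "v \<in> W" "x \<in> W" "v \<notin> Domain E" "x \<notin> Range E" "(x, v) \<notin> E\<^sup>*"
  shows "linear_forest W (insert (v, x) E)"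
  using assms unfolding linear_forest_def single_valued_def
  by (auto simp: acyclic_insert)

lemma linear_forest_card_Domain:
  assumes "linear_forest W E" shows "card (Domain E) = card E"
proof -
  have "inj_on fst E"
    by (auto simp: inj_on_def dest: linear_forest_fun[OF assms])
  then show ?thesis by (simp add: Domain_fst card_image)
qed

lemma linear_forest_card_Range:
  assumes "linear_forest W E" shows "card (Range E) = card E"
proof -
  have "inj_on snd E"
    by (auto simp: inj_on_def dest: linear_forest_inj[OF assms])
  then show ?thesis by (simp add: Range_snd card_image)
qed

lemma linear_forest_card_ends:
  assumes "linear_forest W E"
  shows "card (W - Domain E) = card W - card E" "card (W - Range E) = card W - card E"
    "card E \<le> card W"
proof -
  have "finite W" "Domain E \<subseteq> W" "Range E \<subseteq> W"
    using assms unfolding linear_forest_def by auto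
  then show "card (W - Domain E) = card W - card E" "card (W - Range E) = card W - card E"
    "card E \<le> card W"
    using linear_forest_card_Domain[OF assms] linear_forest_card_Range[OF assms]
    by (metis card_Diff_subset finite_subset card_mono)+
qed

lemma rtrancl_start: "(z, x) \<in> E\<^sup>* \<Longrightarrow> x \<notin> Range E \<Longrightarrow> z = x"
  by (metis Range.intros rtranclE)

lemma rtrancl_end: "(y, z) \<in> E\<^sup>* \<Longrightarrow> y \<notin> Domain E \<Longrightarrow> z = y"
  by (metis Domain.intros converse_rtranclE)

lemma rtrancl_closed: "(x, z) \<in> E\<^sup>* \<Longrightarrow> E `` Y \<subseteq> Y \<Longrightarrow> x \<in> Y \<Longrightarrow> z \<in> Y"
  by (metis Image_closed_trancl ImageI)

text \<open>Predecessors are unique, so two vertices that reach \<open>z\<close> are comparable by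
  confluence, and a vertex without predecessor is reached only from itself.\<close>

lemma linear_forest_starts_eq:
  assumes "linear_forest W E" "x \<notin> Range E" "x' \<notin> Range E" "(x, z) \<in> E\<^sup>*" "(x', z) \<in> E\<^sup>*"
  shows "x = x'"
proof -
  have "single_valued (E\<inverse>)" "(z, x) \<in> (E\<inverse>)\<^sup>*" "(z, x') \<in> (E\<inverse>)\<^sup>*"
    using assms by (auto simp: linear_forest_def rtrancl_converse)
  then have "(x, x') \<in> (E\<inverse>)\<^sup>* \<or> (x', x) \<in> (E\<inverse>)\<^sup>*"
    by (rule single_valued_confluent)
  then show ?thesis using assms(2,3) rtrancl_start by (metis rtrancl_converseD)
qed

lemma linear_forest_ends_eq:
  assumes "linear_forest W E" "y \<notin> Domain E" "y' \<notin> Domain E" "(x, y) \<in> E\<^sup>*" "(x, y') \<in> E\<^sup>*"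
  shows "y = y'"
proof -
  have "(y, y') \<in> E\<^sup>* \<or> (y', y) \<in> E\<^sup>*"
    using assms by (intro single_valued_confluent) (auto simp: linear_forest_def)
  then show ?thesis using assms(2,3) rtrancl_end by metis
qed

text \<open>There is exactly one start \<open>x\<close>. Deleting \<open>x\<close> together with its
  out-edge leaves a forest of the same kind with one edge fewer, and \<open>x\<close> is put in
  front of the list obtained for it.\<close>

lemma linear_forest_path:
  assumes "linear_forest W E" "card W = Suc (card E)"
  shows "\<exists>p. p \<noteq> [] \<and> distinct p \<and> set p = W \<and> (\<forall>i. Suc i < length p \<longrightarrow> (p ! i, p ! Suc i) \<in> E)"
  using assms
proof (induction "card E" arbitrary: W E)
  case 0
  then have "card W = 1" by simp
  then obtain x where "W = {x}" by (rule card_1_singletonE)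
  then show ?case by (intro exI[of _ "[x]"]) auto
next
  case (Suc m)
  note lf = Suc.prems(1)
  have EW: "E \<subseteq> W \<times> W" and finW: "finite W" using lf by (auto simp: linear_forest_def)
  have "card (W - Range E) = 1"
    using linear_forest_card_ends(2)[OF lf] Suc.prems(2) by simp
  then obtain x where x: "W - Range E = {x}" by (rule card_1_singletonE)
  \<comment> \<open>Were \<open>x\<close> isolated, a minimal vertex of \<open>Domain E\<close>
    would be a second start.\<close>
  have "x \<in> Domain E"
  proof (rule ccontr)
    assume nx: "x \<notin> Domain E"
    have "wf E"
      using lf linear_forest_finite[OF lf] by (intro finite_acyclic_wf) (auto simp: linear_forest_def)
    moreover obtain e where "e \<in> E"
      using Suc.hyps(2) by (metis card.empty nat.distinct(1) ex_in_conv)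
    then have "fst e \<in> Domain E" by (metis Domain.intros prod.collapse)
    ultimately obtain z where z: "z \<in> Domain E" "\<And>y. (y, z) \<in> E \<Longrightarrow> y \<notin> Domain E"
      by (metis wfE_min)
    then have "z \<in> W" "z \<noteq> x" using EW nx by auto
    then have "z \<in> Range E" using x by auto
    then show False using z(2) by blast
  qed
  then obtain b where b: "(x, b) \<in> E" by blast
  let ?F = "E - {(x, b)}"
  have F: "linear_forest (W - {x}) ?F"
  proof -
    have "linear_forest W ?F" using lf by (rule linear_forest_subset) auto
    moreover have "?F \<subseteq> (W - {x}) \<times> (W - {x})"
      using EW x linear_forest_fun[OF lf b] by auto
    ultimately show ?thesis by (auto simp: linear_forest_def)
  qed
  have xW: "x \<in> W" using x by auto
  have "card ?F = m" using Suc.hyps(2) b linear_forest_finite[OF lf] by simp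
  moreover have "card (W - {x}) = Suc m" using Suc.hyps(2) Suc.prems(2) xW finW by simp
  ultimately obtain p where p: "p \<noteq> []" "distinct p" "set p = W - {x}"
      "\<forall>i. Suc i < length p \<longrightarrow> (p ! i, p ! Suc i) \<in> ?F"
    using Suc.hyps(1)[OF _ F] by auto
  have "b \<in> set p" using p(3) F EW b x by auto
  then obtain i where i: "i < length p" "p ! i = b" by (metis in_set_conv_nth)
  \<comment> \<open>The only edge into \<open>b\<close> was the deleted one, so \<open>b\<close>
    heads the list \<open>p\<close>.\<close>
  have "i = 0"
  proof (rule ccontr)
    assume "i \<noteq> 0"
    then obtain j where j: "i = Suc j" using not0_implies_Suc by blast
    then have "(p ! j, b) \<in> ?F" using p(4) i by auto
    then show False using linear_forest_inj[OF lf b] by auto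
  qed
  have "(\<forall>k. Suc k < length (x # p) \<longrightarrow> ((x # p) ! k, (x # p) ! Suc k) \<in> E)"
  proof (intro allI impI)
    fix k assume "Suc k < length (x # p)"
    then show "((x # p) ! k, (x # p) ! Suc k) \<in> E"
      using p(4) b i \<open>i = 0\<close> by (cases k) auto
  qed
  moreover have "set (x # p) = W" "distinct (x # p)" using p xW by auto
  ultimately show ?case by (intro exI[of _ "x # p"]) auto
qed

text \<open>Joins two different paths through two new vertices. The edges are inserted from the last
  to the first; each time some closed vertex set contains the head of the new edge but not its tail,
  so no cycle arises.\<close>

lemma linear_forest_connect:
  assumes lf: "linear_forest W E" and y: "y \<in> W" "y \<notin> Domain E" and x: "x \<in> W" "x \<notin> Range E"
    and xy: "(x, y) \<notin> E\<^sup>*" and ab: "a \<notin> W" "b \<notin> W" "a \<noteq> b"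
  shows "linear_forest (insert a (insert b W)) (insert (y, a) (insert (a, b) (insert (b, x) E)))"
proof -
  let ?W = "insert a (insert b W)"
  have EW: "E \<subseteq> W \<times> W" and fin: "finite W" using lf by (auto simp: linear_forest_def)
  have neq: "a \<noteq> x" "a \<noteq> y" "b \<noteq> x" "b \<noteq> y" using ab x y by auto
  have 0: "linear_forest ?W E" using fin by (intro linear_forest_superset[OF lf]) auto
  have "(x, b) \<notin> E\<^sup>*" using rtrancl_closed[of x b E W] EW x ab by blast
  then have 1: "linear_forest ?W (insert (b, x) E)"
    using EW ab x by (intro linear_forest_insert[OF 0]) auto
  have "(b, a) \<notin> (insert (b, x) E)\<^sup>*"
    using rtrancl_closed[of b a "insert (b, x) E" "insert b W"] EW x ab by blast
  then have 2: "linear_forest ?W (insert (a, b) (insert (b, x) E))"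
    using EW ab neq by (intro linear_forest_insert[OF 1]) auto
  let ?Y = "{a, b} \<union> E\<^sup>* `` {x}"
  have "insert (a, b) (insert (b, x) E) `` ?Y \<subseteq> ?Y"
    using EW ab x neq by (auto intro: rtrancl_into_rtrancl)
  moreover have "y \<notin> ?Y" using xy neq by auto
  ultimately have "(a, y) \<notin> (insert (a, b) (insert (b, x) E))\<^sup>*"
    using rtrancl_closed[of a y _ ?Y] by blast
  then show ?thesis
    using EW ab y neq by (intro linear_forest_insert[OF 2]) auto
qed

text \<open>There are \<open>T * T + T\<close> disjoint paths. Fewer than \<open>T * T\<close> of
  them have more than \<open>L = card W div (T * T)\<close> vertices, so \<open>T\<close> starts of
  shorter ones remain, and together these reach at most \<open>T * L\<close> vertices.\<close>

lemma starts_with_small_reach: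
  assumes lf: "linear_forest W E" and q: "card W = card E + (T * T + T)"
  obtains x where "inj_on x {..<T}" "x ` {..<T} \<subseteq> W - Range E"
    "T * card (E\<^sup>* `` (x ` {..<T})) \<le> card W"
proof -
  define L where "L = card W div (T * T)"
  define X where "X = W - Range E"
  define B where "B = {x \<in> X. L < card (E\<^sup>* `` {x})}"
  have finW: "finite W" and EW: "E \<subseteq> W \<times> W" using lf by (auto simp: linear_forest_def)
  have cX: "card X = T * T + T"
    unfolding X_def using linear_forest_card_ends(2)[OF lf] q by simp
  have finX: "finite X" "finite B" using finW by (auto simp: X_def B_def)
  have sub: "E\<^sup>* `` {x} \<subseteq> W" if "x \<in> W" for x
    using that EW rtrancl_closed[of x _ E W] by blast
  have fr: "finite (E\<^sup>* `` {x})" if "x \<in> X" for x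
    using sub[of x] finW that finite_subset by (auto simp: X_def)
  have "card B * Suc L \<le> (\<Sum>x\<in>B. card (E\<^sup>* `` {x}))"
    using sum_bounded_below[of B "Suc L" "\<lambda>x. card (E\<^sup>* `` {x})"] by (auto simp: B_def)
  also have "\<dots> = card (\<Union>x\<in>B. E\<^sup>* `` {x})"
  proof (rule card_UN_disjoint[symmetric])
    show "\<forall>i\<in>B. \<forall>j\<in>B. i \<noteq> j \<longrightarrow> E\<^sup>* `` {i} \<inter> E\<^sup>* `` {j} = {}"
      using linear_forest_starts_eq[OF lf] by (auto simp: B_def X_def)
  qed (use finX fr in \<open>auto simp: B_def\<close>)
  also have "\<dots> \<le> card W"
    using sub by (intro card_mono finW) (auto simp: B_def X_def)
  finally have cB: "card B * Suc L \<le> card W" .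
  have "T \<le> card (X - B)"
  proof (cases "T = 0")
    case False
    have "card B < T * T"
    proof (rule ccontr)
      assume "\<not> card B < T * T"
      then have "T * T * Suc L \<le> card B * Suc L" by (intro mult_right_mono) auto
      then have "T * T * Suc L \<le> card W" using cB by simp
      moreover have "card W < T * T * Suc L"
        unfolding L_def using False by (simp add: dividend_less_times_div)
      ultimately show False by simp
    qed
    moreover have "card (X - B) = card X - card B"
      using finX by (intro card_Diff_subset) (auto simp: B_def)
    ultimately show ?thesis using cX by simp
  qed simp
  then obtain Y where Y: "Y \<subseteq> X - B" "card Y = T" "finite Y"
    by (meson finX finite_Diff obtain_subset_with_card_n finite_subset)
  then obtain x where x: "bij_betw x {..<T} Y"
    using ex_bij_betw_nat_finite[of Y] by (auto simp: atLeast0LessThan)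
  have "card (E\<^sup>* `` Y) = card (\<Union>y\<in>Y. E\<^sup>* `` {y})" by (rule arg_cong[of _ _ card]) auto
  also have "\<dots> \<le> (\<Sum>y\<in>Y. card (E\<^sup>* `` {y}))" using Y(3) by (rule card_UN_le)
  also have "\<dots> \<le> card Y * L"
  proof -
    have "card (E\<^sup>* `` {y}) \<le> L" if "y \<in> Y" for y
      using that Y(1) by (auto simp: B_def not_less)
    then show ?thesis using sum_bounded_above[of Y "\<lambda>y. card (E\<^sup>* `` {y})" L] by simp
  qed
  finally have "card (E\<^sup>* `` Y) \<le> T * L" using Y by simp
  then have "T * card (E\<^sup>* `` Y) \<le> T * T * L" by (simp add: mult.assoc)
  also have "\<dots> \<le> card W" unfolding L_def by (metis div_times_less_eq_dividend mult.commute)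
  finally show ?thesis
    using that[of x] x Y(1) by (auto simp: bij_betw_def X_def)
qed

section \<open>Large rainbow forests with few paths\<close>

locale properly_colored_clique =
  fixes V :: "'a set" and c :: "'a set \<Rightarrow> nat"
  assumes finite_V: "finite V"
    and proper: "\<lbrakk>a \<in> V; b \<in> V; b' \<in> V; a \<noteq> b; a \<noteq> b'; c {a, b} = c {a, b'}\<rbrakk> \<Longrightarrow> b = b'"
begin

definition col :: "'a \<times> 'a \<Rightarrow> nat" where
  "col e = c {fst e, snd e}"

lemma col_Pair [simp]: "col (a, b) = c {a, b}"
  by (simp add: col_def)

text \<open>Properness in counting form: at \<open>x\<close> each color occurs at most once.\<close>

lemma card_colored_neighbours:
  assumes "x \<in> V" "finite F"
  shows "card {v \<in> V. v \<noteq> x \<and> c {x, v} \<in> F} \<le> card F"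
proof (rule card_inj_on_le[of "\<lambda>v. c {x, v}"])
  show "inj_on (\<lambda>v. c {x, v}) {v \<in> V. v \<noteq> x \<and> c {x, v} \<in> F}"
    using proper assms(1) by (auto simp: inj_on_def)
qed (use assms in auto)

text \<open>Take a forest with the most vertices, the number of paths being fixed. Each start
  \<open>x t\<close> adds at least \<open>card X - card S - \<Delta> - card E\<close> vertices to
  the growing set \<open>G\<close>, which never exceeds \<open>card X\<close>. After
  \<open>T\<close> rounds, with \<open>T * card S \<le> card X\<close>, the bound follows.\<close>

lemma large_rainbow_forest:
  assumes XV: "X \<subseteq> V"
    and deg: "\<And>v. v \<in> X \<Longrightarrow> card {w \<in> V. w \<noteq> v \<and> c {v, w} \<in> K} \<le> \<Delta>"
    and q: "T * T + T \<le> card X"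
  obtains W E where "W \<subseteq> X" "linear_forest W E" "card W = card E + (T * T + T)"
    "inj_on col E" "col ` E \<inter> K = {}"
    "T * card X \<le> T * (card W + \<Delta>) + 2 * card X"
proof -
  define P where "P = (\<lambda>(W, E). W \<subseteq> X \<and> linear_forest W E \<and> card W = card E + (T * T + T) \<and>
    inj_on col E \<and> col ` E \<inter> K = {})"
  have finX: "finite X" using XV finite_V finite_subset by blast
  obtain W0 where W0: "W0 \<subseteq> X" "card W0 = T * T + T" "finite W0"
    using q obtain_subset_with_card_n by metis
  \<comment> \<open>Isolated vertices are trivial paths, so a competitor exists.\<close>
  then have "P (W0, {})"
    by (auto simp: P_def linear_forest_def acyclic_def)
  moreover have "\<forall>w. P w \<longrightarrow> card (fst w) < Suc (card X)"
    using card_mono[OF finX] unfolding P_def less_Suc_eq_le by (metis (no_types, lifting) case_prod_beta)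
  ultimately obtain WE where WE: "P WE" "\<forall>w. P w \<longrightarrow> card (fst w) \<le> card (fst WE)"
    using ex_has_greatest_nat[of P _ "\<lambda>w. card (fst w)" "Suc (card X)"] by blast
  obtain W E where WE_eq: "WE = (W, E)" by fastforce
  have WX: "W \<subseteq> X" and lf: "linear_forest W E" and cW: "card W = card E + (T * T + T)"
    and inj: "inj_on col E" and nK: "col ` E \<inter> K = {}"
    using WE(1) by (auto simp: P_def WE_eq)
  have maximal: "card W' \<le> card W"
    if "W' \<subseteq> X" "linear_forest W' E'" "card W' = card E' + (T * T + T)"
      "inj_on col E'" "col ` E' \<inter> K = {}" for W' E'
    using WE(2)[rule_format, of "(W', E')"] that by (simp add: P_def WE_eq)
  have finW: "finite W" and EW: "E \<subseteq> W \<times> W" using lf by (auto simp: linear_forest_def)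
  have finE: "finite E" using linear_forest_finite[OF lf] .
  have "T * card X \<le> T * (card W + \<Delta>) + 2 * card X"
  proof (cases "W = X")
    case False
    then obtain u where u: "u \<in> X" "u \<notin> W" using WX by blast
    obtain x where x: "inj_on x {..<T}" "x ` {..<T} \<subseteq> W - Range E"
      and small: "T * card (E\<^sup>* `` (x ` {..<T})) \<le> card W"
      using starts_with_small_reach[OF lf cW] by blast
    define S where "S = E\<^sup>* `` (x ` {..<T})"
    have SW: "S \<subseteq> W"
    proof
      fix z assume "z \<in> S"
      then obtain i where "i < T" "(x i, z) \<in> E\<^sup>*" by (auto simp: S_def)
      then show "z \<in> W" using EW x(2) rtrancl_closed[of "x i" z E W] by blast
    qed
    have xS: "x i \<in> S" if "i < T" for i using that by (auto simp: S_def)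
    have xX: "x i \<in> W" "x i \<in> X" "x i \<in> V" "x i \<notin> Range E" if "i < T" for i
      using x(2) that WX XV by auto
    have S_closed: "b \<in> S" if "a \<in> S" "(a, b) \<in> E" for a b
      using that unfolding S_def by (auto intro: rtrancl_into_rtrancl)
    \<comment> \<open>Vertices of \<open>G t\<close> are those whose original out-edge can be freed by redirecting edges to
      \<open>x 0, \<dots>, x (t - 1)\<close> only. No edge leaving \<open>S\<close> is ever redirected, so no cycle can arise.\<close>
    define G where "G = rec_nat {} (\<lambda>t Gt. Gt \<union>
      {z \<in> Domain E - S. c {x t, z} \<notin> K \<and> c {x t, z} \<notin> col ` {e \<in> E. fst e \<notin> Gt}})"
    have G0: "G 0 = {}" and GS: "\<And>t. G (Suc t) = G t \<union>
      {z \<in> Domain E - S. c {x t, z} \<notin> K \<and> c {x t, z} \<notin> col ` {e \<in> E. fst e \<notin> G t}}"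
      by (simp_all add: G_def)
    have GD: "G t \<subseteq> Domain E" for t
      by (induction t) (auto simp: G0 GS)
    \<comment> \<open>Equal domains keep the edge count. Since edges out of \<open>S\<close> are
      original, \<open>S\<close> stays closed, which excludes cycles. The last clause says that
      out-edges of vertices outside \<open>G t\<close> are still the original ones.\<close>
    define state where "state = (\<lambda>t F. linear_forest W F \<and> Domain F = Domain E \<and> inj_on col F \<and>
      col ` F \<inter> K = {} \<and> (\<forall>i\<in>{t..<T}. x i \<notin> Range F) \<and>
      (\<forall>a\<in>S. \<forall>b. (a, b) \<in> F \<longrightarrow> (a, b) \<in> E) \<and> (\<forall>a b. (a, b) \<in> F - E \<longrightarrow> a \<in> G t))"
    have state_mono: "state (Suc t) F" if "state t F" for t F
      using that by (auto simp: state_def GS)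
    have unreach: "(x t, v) \<notin> F\<^sup>*" if "state t F" "t < T" "v \<notin> S" for t F v
    proof
      assume "(x t, v) \<in> F\<^sup>*"
      moreover have "F `` S \<subseteq> S" using that(1) S_closed by (auto simp: state_def)
      ultimately show False using rtrancl_closed xS that(2,3) by metis
    qed
    have no_augment: False
      if st: "state t F" and t: "t < T" and v: "v \<in> X" "v \<notin> S" "v \<notin> Domain E"
        and f: "c {x t, v} \<notin> K" "c {x t, v} \<notin> col ` F" for t F v
    proof -
      \<comment> \<open>If \<open>v\<close> lies in \<open>W\<close>, the new edge merges two paths
        and the spare vertex \<open>u\<close> enters as a trivial path; otherwise \<open>v\<close>
        is prepended to a path. Either way one vertex and one edge are gained, against
        maximality.\<close>
      define W' where "W' = insert (if v \<in> W then u else v) W"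
      have lfF: "linear_forest W F" using st by (simp add: state_def)
      have finF: "finite F" using linear_forest_finite[OF lfF] .
      have cF: "card F = card E"
        using linear_forest_card_Domain[OF lf] linear_forest_card_Domain[OF lfF] st
        by (simp add: state_def)
      have W': "finite W'" "W \<subseteq> W'" "W' \<subseteq> X" "card W' = Suc (card W)" "v \<in> W'"
        using finW u v WX by (auto simp: W'_def)
      have vD: "v \<notin> Domain F" using st v by (simp add: state_def)
      have lf': "linear_forest W' (insert (v, x t) F)"
      proof (rule linear_forest_insert)
        show "linear_forest W' F" using linear_forest_superset[OF lfF] W' by blast
        show "x t \<notin> Range F" using st t by (simp add: state_def)
        show "(x t, v) \<notin> F\<^sup>*" using unreach st t v by blast
      qed (use W' vD xX t in auto)
      have "card (insert (v, x t) F) = Suc (card F)"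
        using vD finF by (subst card_insert_disjoint) auto
      moreover have "inj_on col (insert (v, x t) F)"
        using st f by (auto simp: state_def insert_commute)
      moreover have "col ` insert (v, x t) F \<inter> K = {}"
        using st f by (auto simp: state_def insert_commute)
      ultimately show False
        using maximal[OF W'(3) lf'] W'(4) cF cW by simp
    qed
    \<comment> \<open>A color that only occurs on edges leaving \<open>G t\<close> can be avoided by
      some rearrangement. If \<open>f\<close> sits on the out-edge of a vertex \<open>v\<close> new
      in \<open>G (Suc t)\<close>, the induction hypothesis is applied not to \<open>f\<close> but
      to the color of the pair \<open>x t\<close>, \<open>v\<close>; redirecting \<open>v\<close> to
      \<open>x t\<close> then discards \<open>f\<close>.\<close>
    have ex_state: "\<exists>F. state t F \<and> f \<notin> col ` F"
      if "t \<le> T" "f \<notin> col ` {e \<in> E. fst e \<notin> G t}" for t f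
      using that
    proof (induction t arbitrary: f)
      case 0
      have "state 0 E" using lf inj nK xX by (auto simp: state_def)
      then show ?case using 0 by (auto simp: G0)
    next
      case (Suc t)
      show ?case
      proof (cases "f \<in> col ` {e \<in> E. fst e \<notin> G t}")
        case False
        then show ?thesis using Suc.IH[of f] Suc.prems state_mono by (meson Suc_leD)
      next
        case True
        then obtain v b where vb: "(v, b) \<in> E" "v \<notin> G t" "f = col (v, b)" by auto
        then have vG: "v \<in> G (Suc t)" using Suc.prems(2) by (auto simp del: col_Pair)
        then have v: "v \<notin> S" "c {x t, v} \<notin> K" "c {x t, v} \<notin> col ` {e \<in> E. fst e \<notin> G t}"
          using vb(2) by (auto simp: GS)
        obtain F where F: "state t F" "c {x t, v} \<notin> col ` F"
          using Suc.IH[OF _ v(3)] Suc.prems by auto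
        have lfF: "linear_forest W F" using F by (simp add: state_def)
        \<comment> \<open>Because \<open>v\<close> is not in \<open>G t\<close>, its out-edge in
          \<open>F\<close> is still \<open>(v, b)\<close>, the one edge of \<open>F\<close> with
          color \<open>f\<close>.\<close>
        have "v \<in> Domain F" using F(1) vb(1) by (auto simp: state_def)
        then obtain b' where "(v, b') \<in> F" by blast
        moreover have "(v, b') \<in> E" using F(1) vb(2) calculation by (auto simp: state_def)
        ultimately have vbF: "(v, b) \<in> F" using linear_forest_fun[OF lf] vb(1) by metis
        let ?F = "F - {(v, b)}"
        let ?F' = "insert (v, x t) ?F"
        have t: "t < T" using Suc.prems by simp
        have xR: "x i \<notin> Range F" if "t \<le> i" "i < T" for i
          using F(1) that by (simp add: state_def)
        have vW: "v \<in> W" using vb(1) EW by auto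
        have lf0: "linear_forest W ?F" using linear_forest_subset[OF lfF] by blast
        have "linear_forest W ?F'"
        proof (rule linear_forest_insert[OF lf0 vW xX(1)[OF t]])
          show "v \<notin> Domain ?F" using linear_forest_fun[OF lfF vbF] by auto
          show "x t \<notin> Range ?F" using xR t by auto
          show "(x t, v) \<notin> ?F\<^sup>*"
            using unreach[OF F(1) t v(1)] rtrancl_mono[of ?F F] by blast
        qed
        moreover have "Domain ?F' = Domain E" using F(1) vb(1) by (auto simp: state_def)
        moreover have "inj_on col ?F'"
          using F by (auto simp: state_def insert_commute intro: inj_on_diff)
        moreover have "col ` ?F' \<inter> K = {}"
          using F v(2) by (auto simp: state_def insert_commute)
        moreover have "\<forall>i\<in>{Suc t..<T}. x i \<notin> Range ?F'"
        proof
          fix i assume i: "i \<in> {Suc t..<T}"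
          then have "x i \<noteq> x t" using inj_onD[OF x(1), of i t] t by auto
          then show "x i \<notin> Range ?F'" using xR[of i] i by auto
        qed
        moreover have "\<forall>a\<in>S. \<forall>b. (a, b) \<in> ?F' \<longrightarrow> (a, b) \<in> E"
          using F(1) v(1) by (auto simp: state_def)
        moreover have "\<forall>a b. (a, b) \<in> ?F' - E \<longrightarrow> a \<in> G (Suc t)"
          using F(1) vG by (auto simp: state_def GS)
        ultimately have "state (Suc t) ?F'" by (simp add: state_def)
        moreover have "f \<notin> col ` ?F'"
        proof -
          have "inj_on col F" using F(1) by (simp add: state_def)
          then have "f \<notin> col ` ?F"
            using vbF vb(3) by (auto simp del: col_Pair dest: inj_onD)
          moreover have "f \<noteq> col (v, x t)"
            using F(2) vbF vb(3) by (auto simp: insert_commute intro: rev_image_eqI)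
          ultimately show ?thesis by simp
        qed
        ultimately show ?thesis by blast
      qed
    qed
    \<comment> \<open>Suppose the color from \<open>x t\<close> to \<open>v\<close> is neither in
      \<open>K\<close> nor on an edge of \<open>C\<close>, and \<open>v\<close> is outside
      \<open>S\<close>. If \<open>v\<close> has an out-edge, it belongs to \<open>G (Suc t)\<close>;
      if not, \<open>ex_state\<close> and \<open>no_augment\<close> clash. The exceptions are
      counted by \<open>\<Delta>\<close>, \<open>card C\<close> and \<open>card S\<close>, and
      \<open>C\<close> loses one edge for each vertex of \<open>G t\<close>.\<close>
    have grow: "card X + card (G t) \<le> card (G (Suc t)) + (card S + \<Delta> + card E)" if t: "t < T" for t
    proof -
      define C where "C = {e \<in> E. fst e \<notin> G t}"
      have "X \<subseteq> G (Suc t) \<union> S \<union> {w \<in> V. w \<noteq> x t \<and> c {x t, w} \<in> K} \<union>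
        {w \<in> V. w \<noteq> x t \<and> c {x t, w} \<in> col ` C}"
      proof
        fix v assume v: "v \<in> X"
        show "v \<in> G (Suc t) \<union> S \<union> {w \<in> V. w \<noteq> x t \<and> c {x t, w} \<in> K} \<union>
          {w \<in> V. w \<noteq> x t \<and> c {x t, w} \<in> col ` C}"
        proof (rule ccontr)
          assume "\<not> ?thesis"
          then have vv: "v \<notin> G (Suc t)" "v \<notin> S" "c {x t, v} \<notin> K" "c {x t, v} \<notin> col ` C"
            using v XV xS[OF t] by auto
          then have vD: "v \<notin> Domain E" by (auto simp: GS C_def)
          obtain F where "state t F" "c {x t, v} \<notin> col ` F"
            using ex_state[of t "c {x t, v}"] t vv(4) by (auto simp: C_def)
          then show False using no_augment t v vv vD by blast
        qed
      qed
      moreover have "finite (G (Suc t))" using GD finE finite_subset finite_Domain by metis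
      moreover have "finite S" using SW finW finite_subset by blast
      ultimately have "card X \<le> card (G (Suc t) \<union> S \<union> {w \<in> V. w \<noteq> x t \<and> c {x t, w} \<in> K} \<union>
        {w \<in> V. w \<noteq> x t \<and> c {x t, w} \<in> col ` C})"
        using finite_V by (intro card_mono) auto
      also have "\<dots> \<le> card (G (Suc t)) + card S + card {w \<in> V. w \<noteq> x t \<and> c {x t, w} \<in> K} +
        card {w \<in> V. w \<noteq> x t \<and> c {x t, w} \<in> col ` C}"
        by (meson card_Un_le add_le_mono le_trans order_refl)
      also have "\<dots> \<le> card (G (Suc t)) + card S + \<Delta> + card C"
      proof -
        have "finite C" using finE by (simp add: C_def)
        then have "card {w \<in> V. w \<noteq> x t \<and> c {x t, w} \<in> col ` C} \<le> card C"
          using card_colored_neighbours[of "x t" "col ` C"] xX[OF t] card_image_le[of C col] by force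
        then show ?thesis using deg[OF xX(2)[OF t]] by linarith
      qed
      finally have 1: "card X \<le> card (G (Suc t)) + card S + \<Delta> + card C" .
      have "card C + card (G t) \<le> card E"
      proof -
        have "G t \<subseteq> fst ` (E - C)" using GD[of t] by (force simp: C_def)
        then have "card (G t) \<le> card (E - C)"
          using finE by (meson card_image_le card_mono finite_Diff finite_imageI le_trans)
        moreover have "card (E - C) = card E - card C" "card C \<le> card E"
          using finE by (auto simp: C_def card_Diff_subset card_mono)
        ultimately show ?thesis by linarith
      qed
      then show ?thesis using 1 by linarith
    qed
    have "t * card X \<le> card (G t) + t * (card S + \<Delta> + card E)" if "t \<le> T" for t
      using that
    proof (induction t)
      case (Suc t)
      then show ?case using grow[of t] by (simp add: algebra_simps)
    qed simp
    from this[of T] have "T * card X \<le> card (G T) + T * (card S + \<Delta> + card E)" by simp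
    moreover have "card (G T) \<le> card X"
      using GD[of T] EW WX finX by (intro card_mono) auto
    moreover have "T * card S \<le> card X"
      using small card_mono[OF finX WX] by (simp add: S_def)
    moreover have "T * card E \<le> T * card W" using cW by simp
    ultimately show ?thesis unfolding distrib_left by linarith
  qed (simp add: distrib_left)
  then show thesis using that WX lf cW inj nK by blast
qed

end

section \<open>Expanding color classes\<close>

text \<open>Union bound by counting. \<open>bad (j, D)\<close> collects the maps for which
  \<open>D\<close> misses class \<open>j\<close>, a fraction \<open>((k - 1) / k) ^ d\<close> of all
  maps, and there are \<open>k * card \<D>\<close> such events.\<close>

lemma ex_partition_hitting:
  fixes Col :: "'b set" and k d :: nat
  assumes "finite Col" "finite \<D>" and D: "\<And>D. D \<in> \<D> \<Longrightarrow> D \<subseteq> Col \<and> card D = d"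
    and k: "0 < k" and less: "k * card \<D> * (k - 1) ^ d < k ^ d"
  obtains f :: "'b \<Rightarrow> nat" where "\<And>x. f x < k" "\<And>j D. j < k \<Longrightarrow> D \<in> \<D> \<Longrightarrow> \<exists>x\<in>D. f x = j"
proof (cases "\<D> = {}")
  case True
  then show ?thesis using that[of "\<lambda>_. 0"] k by simp
next
  case False
  define N where "N = card Col"
  define bad where "bad = (\<lambda>(j, D). PiE Col (\<lambda>x. if x \<in> D then {..<k} - {j} else {..<k}))"
  have dN: "d \<le> N" using False D card_mono[OF assms(1)] unfolding N_def by (metis ex_in_conv)
  have card_bad: "card (bad (j, D)) = (k - 1) ^ d * k ^ (N - d)" if "j < k" "D \<in> \<D>" for j D
  proof -
    have "card (bad (j, D)) = (\<Prod>x\<in>Col. if x \<in> D then k - 1 else k)"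
      unfolding bad_def using that assms(1) by (auto simp: card_PiE intro!: prod.cong)
    also have "\<dots> = (k - 1) ^ card (Col \<inter> D) * k ^ card (Col - D)"
      using assms(1) by (simp add: prod.If_cases Diff_eq)
    also have "Col \<inter> D = D" using D that by blast
    also have "card (Col - D) = N - d"
      using D[OF that(2)] assms(1) by (metis N_def card_Diff_subset finite_subset)
    finally show ?thesis using D that by simp
  qed
  have "card (\<Union>p\<in>{..<k} \<times> \<D>. bad p) \<le> (\<Sum>p\<in>{..<k} \<times> \<D>. card (bad p))"
    using assms by (intro card_UN_le) auto
  also have "\<dots> = (\<Sum>p\<in>{..<k} \<times> \<D>. (k - 1) ^ d * k ^ (N - d))"
    using card_bad by (intro sum.cong) auto
  also have "\<dots> = (k * card \<D> * (k - 1) ^ d) * k ^ (N - d)"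
    by (simp add: card_cartesian_product)
  also have "\<dots> < k ^ d * k ^ (N - d)" using less k by simp
  also have "\<dots> = card (PiE Col (\<lambda>_. {..<k}))"
    using dN assms(1) by (simp add: card_PiE power_add[symmetric] N_def)
  finally have lt: "card (\<Union>p\<in>{..<k} \<times> \<D>. bad p) < card (PiE Col (\<lambda>_. {..<k}))" .
  have "finite (\<Union>p\<in>{..<k} \<times> \<D>. bad p)"
    using assms by (auto simp: bad_def intro!: finite_PiE)
  then have "\<not> PiE Col (\<lambda>_. {..<k}) \<subseteq> (\<Union>p\<in>{..<k} \<times> \<D>. bad p)"
    using card_mono lt by (metis not_less)
  then obtain g where g: "g \<in> PiE Col (\<lambda>_. {..<k})" "g \<notin> (\<Union>p\<in>{..<k} \<times> \<D>. bad p)"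
    by blast
  \<comment> \<open>Outside \<open>Col\<close> the extensional function \<open>g\<close> is
    undefined; the value 0 keeps \<open>f x < k\<close> everywhere.\<close>
  define f where "f = (\<lambda>x. if x \<in> Col then g x else 0)"
  show ?thesis
  proof (rule that[of f])
    show "f x < k" for x using g(1) k by (auto simp: f_def PiE_iff)
    show "\<exists>x\<in>D. f x = j" if "j < k" "D \<in> \<D>" for j D
    proof (rule ccontr)
      assume no: "\<not> ?thesis"
      have "g \<in> bad (j, D)"
        unfolding bad_def using g(1) no D[OF that(2)] by (auto simp: f_def PiE_iff)
      then show False using g(2) that by auto
    qed
  qed
qed

context properly_colored_clique
begin

text \<open>The two sides have different sizes because \<open>s * s * s + s\<close> vertices in
  \<open>B\<close> are what it takes to find a rainbow \<open>s\<close> by \<open>s\<close>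
  biclique, and only those are controlled by the random partition.\<close>

definition expanding :: "nat \<Rightarrow> nat set \<Rightarrow> bool" where
  "expanding s K \<longleftrightarrow> (\<forall>A B. A \<subseteq> V \<and> B \<subseteq> V \<and> A \<inter> B = {} \<and> card A = s \<and> s * s * s + s \<le> card B \<longrightarrow>
     (\<exists>a\<in>A. \<exists>b\<in>B. c {a, b} \<in> K))"

text \<open>Take \<open>Y\<close> largest with \<open>A \<times> Y\<close> rainbow. Every other
  \<open>b\<close> in \<open>B\<close> sees some \<open>a\<close> in \<open>A\<close> in a color
  already used on \<open>A \<times> Y\<close>, and each \<open>a\<close> admits at most
  \<open>s * card Y\<close> such \<open>b\<close>. If \<open>card Y < s\<close>, then
  \<open>B\<close> would have fewer than \<open>s * s * s + s\<close> vertices.\<close>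

lemma rainbow_biclique:
  assumes A: "A \<subseteq> V" "card A = s" and B: "B \<subseteq> V" "A \<inter> B = {}" "s * s * s + s \<le> card B" and s: "0 < s"
  obtains B' where "B' \<subseteq> B" "card B' = s" "inj_on col (A \<times> B')"
proof -
  have finA: "finite A" "finite B" using A B finite_V finite_subset by auto
  define P where "P = (\<lambda>B'. B' \<subseteq> B \<and> inj_on col (A \<times> B'))"
  have "\<forall>Y. P Y \<longrightarrow> card Y < Suc (card B)"
    using finA(2) by (simp add: P_def card_mono less_Suc_eq_le)
  moreover have "P {}" by (simp add: P_def)
  ultimately obtain Y where "P Y" and maximal: "\<forall>Z. P Z \<longrightarrow> card Z \<le> card Y"
    using ex_has_greatest_nat[of P "{}" card "Suc (card B)"] by blast
  then have Y: "Y \<subseteq> B" "inj_on col (A \<times> Y)" by (simp_all add: P_def)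
  have finY: "finite Y" using Y(1) finA finite_subset by blast
  have "s \<le> card Y"
  proof (rule ccontr)
    assume less: "\<not> s \<le> card Y"
    have "B - Y \<subseteq> (\<Union>a\<in>A. {b \<in> V. b \<noteq> a \<and> c {a, b} \<in> col ` (A \<times> Y)})"
    proof
      fix b assume b: "b \<in> B - Y"
      then have "card (insert b Y) > card Y" using finY by simp
      then have "\<not> inj_on col (A \<times> insert b Y)" using maximal[rule_format, of "insert b Y"] Y(1) b by (auto simp: P_def not_le)
      then obtain e e' where e: "e \<in> A \<times> insert b Y" "e' \<in> A \<times> insert b Y" "e \<noteq> e'" "col e = col e'"
        unfolding inj_on_def by blast
      have bV: "b \<in> V" "b \<notin> A" using b B by auto
      have hit: "b \<in> (\<Union>a\<in>A. {b \<in> V. b \<noteq> a \<and> c {a, b} \<in> col ` (A \<times> Y)})"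
        if "a \<in> A" "(a', y) \<in> A \<times> Y" "c {a, b} = c {a', y}" for a a' y
      proof -
        have "c {a, b} \<in> col ` (A \<times> Y)" using that by (auto intro!: rev_image_eqI[of "(a', y)"])
        then show ?thesis using that bV by blast
      qed
      show "b \<in> (\<Union>a\<in>A. {b \<in> V. b \<noteq> a \<and> c {a, b} \<in> col ` (A \<times> Y)})"
      \<comment> \<open>Two clashing edges at \<open>b\<close> contradict properness, two edges off
        \<open>b\<close> contradict the choice of \<open>Y\<close>; in the mixed cases the color at
        \<open>b\<close> is an old one.\<close>
      proof (cases "snd e = b"; cases "snd e' = b")
        assume eb: "snd e = b" "snd e' = b"
        then have "fst e = fst e'"
        proof (intro proper[of b])
          show "c {b, fst e} = c {b, fst e'}" using e(4) eb by (simp add: col_def insert_commute)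
        qed (use e bV A(1) in auto)
        then show ?thesis using eb e(3) by (simp add: prod_eq_iff)
      next
        assume "snd e = b" "snd e' \<noteq> b"
        then show ?thesis using e hit[of "fst e" "fst e'" "snd e'"] by (auto simp: col_def)
      next
        assume "snd e \<noteq> b" "snd e' = b"
        then show ?thesis using e hit[of "fst e'" "fst e" "snd e"] by (auto simp: col_def)
      next
        assume "snd e \<noteq> b" "snd e' \<noteq> b"
        then have "e \<in> A \<times> Y" "e' \<in> A \<times> Y" using e by auto
        then show ?thesis using Y(2) e by (auto simp: inj_on_def)
      qed
    qed
    then have "card (B - Y) \<le> card (\<Union>a\<in>A. {b \<in> V. b \<noteq> a \<and> c {a, b} \<in> col ` (A \<times> Y)})"
      using finA finite_V by (intro card_mono) auto
    also have "\<dots> \<le> (\<Sum>a\<in>A. card {b \<in> V. b \<noteq> a \<and> c {a, b} \<in> col ` (A \<times> Y)})"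
      using finA by (intro card_UN_le) auto
    also have "\<dots> \<le> of_nat (card A) * (s * card Y)"
    proof (rule sum_bounded_above)
      fix a assume "a \<in> A"
      then have "card {b \<in> V. b \<noteq> a \<and> c {a, b} \<in> col ` (A \<times> Y)} \<le> card (col ` (A \<times> Y))"
        using A finA finY by (intro card_colored_neighbours) auto
      also have "\<dots> \<le> card (A \<times> Y)" using finA finY by (intro card_image_le) auto
      finally show "card {b \<in> V. b \<noteq> a \<and> c {a, b} \<in> col ` (A \<times> Y)} \<le> s * card Y"
        using A by (simp add: card_cartesian_product)
    qed
    finally have "card (B - Y) \<le> s * s * card Y" using A by (simp add: mult.assoc)
    moreover have "card (B - Y) = card B - card Y"
      using Y(1) finY by (intro card_Diff_subset) auto
    ultimately have "card B \<le> s * s * card Y + card Y" by linarith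
    moreover have "s * s * card Y \<le> s * s * s" using less by (intro mult_left_mono) auto
    ultimately show False using B(3) less by linarith
  qed
  then obtain B' where "B' \<subseteq> Y" "card B' = s" using obtain_subset_with_card_n by metis
  moreover have "inj_on col (A \<times> B')"
    using Y(2) calculation by (meson Sigma_mono inj_on_subset order_refl)
  ultimately show ?thesis using that Y(1) by blast
qed

text \<open>The hitting lemma is applied to the color sets of all rainbow \<open>s\<close> by
  \<open>s\<close> bicliques. Each has \<open>s * s\<close> colors, and there are at most
  \<open>card V ^ (2 * s)\<close> of them.\<close>

lemma ex_expanding_color_partition:
  assumes s: "0 < s" and k: "0 < k" and less: "k * card V ^ (2 * s) * (k - 1) ^ (s * s) < k ^ (s * s)"
  obtains f :: "nat \<Rightarrow> nat" where "\<forall>e. f e < k" "\<forall>j<k. expanding s {e. f e = j}"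
proof -
  define Q where "Q = {A. A \<subseteq> V \<and> card A = s}"
  define \<D> where "\<D> = (\<lambda>(A, B). col ` (A \<times> B)) ` {p \<in> Q \<times> Q. inj_on col (fst p \<times> snd p)}"
  have finQ: "finite Q" using finite_V by (simp add: Q_def)
  have "card Q = card V choose s" using finite_V by (simp add: Q_def n_subsets)
  also have "\<dots> \<le> card V ^ s"
    by (cases "s \<le> card V") (auto simp: binomial_le_pow binomial_eq_0)
  finally have cQ: "card Q \<le> card V ^ s" .
  have "card \<D> \<le> card {p \<in> Q \<times> Q. inj_on col (fst p \<times> snd p)}"
    unfolding \<D>_def using finQ by (intro card_image_le) auto
  also have "\<dots> \<le> card (Q \<times> Q)" using finQ by (intro card_mono) auto
  also have "\<dots> \<le> card V ^ s * card V ^ s"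
    using cQ by (simp add: card_cartesian_product mult_mono)
  also have "\<dots> = card V ^ (2 * s)" by (simp add: mult_2 power_add)
  finally have cD: "card \<D> \<le> card V ^ (2 * s)" .
  have "k * card \<D> * (k - 1) ^ (s * s) \<le> k * card V ^ (2 * s) * (k - 1) ^ (s * s)"
    using cD by (intro mult_mono) auto
  then have lt: "k * card \<D> * (k - 1) ^ (s * s) < k ^ (s * s)" using less by linarith
  obtain f :: "nat \<Rightarrow> nat" where f: "\<And>e. f e < k" "\<And>j D. j < k \<Longrightarrow> D \<in> \<D> \<Longrightarrow> \<exists>x\<in>D. f x = j"
  proof (rule ex_partition_hitting[of "col ` (V \<times> V)" \<D> "s * s" k])
    show "finite (col ` (V \<times> V))" using finite_V by simp
    show "finite \<D>" using finQ by (simp add: \<D>_def)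
    show "D \<subseteq> col ` (V \<times> V) \<and> card D = s * s" if "D \<in> \<D>" for D
      using that by (auto simp: \<D>_def Q_def card_image card_cartesian_product)
  qed (use k lt in auto)
  have "\<exists>a\<in>A. \<exists>b\<in>B. c {a, b} \<in> {e. f e = j}"
    if *: "j < k" "A \<subseteq> V" "B \<subseteq> V" "A \<inter> B = {}" "card A = s" "s * s * s + s \<le> card B" for j A B
  proof -
    obtain B' where B': "B' \<subseteq> B" "card B' = s" "inj_on col (A \<times> B')"
      using rainbow_biclique[OF *(2,5,3,4,6) s] .
    then have "col ` (A \<times> B') \<in> \<D>" using * by (force simp: \<D>_def Q_def)
    then obtain a b where "a \<in> A" "b \<in> B'" "f (c {a, b}) = j" using f(2)[OF *(1)] by force
    then show ?thesis using B'(1) by blast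
  qed
  then show ?thesis using that[of f] f(1) by (simp add: expanding_def)
qed

subsection \<open>Connecting the paths of a forest\<close>

text \<open>\<open>A\<close> consists of usable neighbours of \<open>y\<close>, \<open>B\<close> of
  usable neighbours of \<open>x\<close>, and expansion supplies the middle edge. The constant
  \<open>d\<close> is the exact budget for \<open>B\<close>: \<open>2 * q\<close> vertices are lost
  to \<open>Z\<close>, \<open>s\<close> to \<open>A\<close>, \<open>3 * q + s\<close> to the colors
  \<open>U'\<close> and \<open>s * (3 * q)\<close> to \<open>D\<close>, which leaves
  \<open>s * s * s + s\<close>.\<close>

lemma ex_rainbow_connection:
  assumes RV: "R \<subseteq> V" and fU: "finite U" and U: "card U \<le> 3 * q"
    and Z: "card (Z \<inter> R) \<le> 2 * q"
    and xy: "x \<in> V - R" "y \<in> V - R"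
    and deg: "d \<le> card {r \<in> R. c {x, r} \<in> K}" "d \<le> card {r \<in> R. c {y, r} \<in> K}"
    and d: "s * s * s + 3 * s + 5 * q + s * (3 * q) \<le> d"
    and expand: "expanding s K"
  obtains a b where "a \<in> R - Z" "b \<in> R - Z" "a \<noteq> b"
    "c {y, a} \<in> K - U" "c {a, b} \<in> K - U" "c {b, x} \<in> K - U"
    "c {y, a} \<noteq> c {a, b}" "c {a, b} \<noteq> c {b, x}" "c {y, a} \<noteq> c {b, x}"
proof -
  have finR: "finite R" using RV finite_V finite_subset by blast
  define A0 where "A0 = {a \<in> R - Z. c {y, a} \<in> K - U}"
  have "{r \<in> R. c {y, r} \<in> K} \<subseteq> A0 \<union> (Z \<inter> R) \<union> {r \<in> V. r \<noteq> y \<and> c {y, r} \<in> U}"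
    using RV xy by (auto simp: A0_def)
  then have "card {r \<in> R. c {y, r} \<in> K} \<le> card (A0 \<union> (Z \<inter> R) \<union> {r \<in> V. r \<noteq> y \<and> c {y, r} \<in> U})"
    using finR finite_V by (intro card_mono) (auto simp: A0_def)
  also have "\<dots> \<le> card A0 + card (Z \<inter> R) + card {r \<in> V. r \<noteq> y \<and> c {y, r} \<in> U}"
    by (meson card_Un_le add_le_mono le_trans order_refl)
  also have "\<dots> \<le> card A0 + 2 * q + 3 * q"
    using Z U card_colored_neighbours[OF _ fU, of y] xy by (intro add_mono) auto
  finally have "s \<le> card A0" using deg(2) d by linarith
  then obtain A where A: "A \<subseteq> A0" "card A = s" "finite A"
    using obtain_subset_with_card_n by metis
  \<comment> \<open>Forbidding the colors from \<open>y\<close> to \<open>A\<close> at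
    \<open>x\<close> makes the two outer edges of the connection differ in color.\<close>
  define U' where "U' = U \<union> (\<lambda>a. c {y, a}) ` A"
  have fU': "finite U'" and cU': "card U' \<le> 3 * q + s"
  proof -
    show "finite U'" using fU A by (simp add: U'_def)
    have "card U' \<le> card U + card ((\<lambda>a. c {y, a}) ` A)" unfolding U'_def by (rule card_Un_le)
    also have "card ((\<lambda>a. c {y, a}) ` A) \<le> s" using A card_image_le by metis
    finally show "card U' \<le> 3 * q + s" using U by linarith
  qed
  define B where "B = {b \<in> R - Z - A. c {x, b} \<in> K - U' \<and> (\<forall>a\<in>A. c {a, b} \<notin> U)}"
  \<comment> \<open>Expansion does not say which \<open>a\<close> it picks, so \<open>b\<close> must
    avoid used colors towards all of \<open>A\<close>.\<close>
  define D where "D = (\<Union>a\<in>A. {r \<in> V. r \<noteq> a \<and> c {a, r} \<in> U})"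
  have AR: "A \<subseteq> R" using A by (auto simp: A0_def)
  have cD: "card D \<le> s * (3 * q)"
  proof -
    have "card D \<le> (\<Sum>a\<in>A. card {r \<in> V. r \<noteq> a \<and> c {a, r} \<in> U})"
      unfolding D_def using A by (intro card_UN_le) auto
    also have "\<dots> \<le> of_nat (card A) * (3 * q)"
    proof (rule sum_bounded_above)
      fix a assume "a \<in> A"
      then have "a \<in> V" using AR RV by auto
      then show "card {r \<in> V. r \<noteq> a \<and> c {a, r} \<in> U} \<le> 3 * q"
        using card_colored_neighbours[OF _ fU] U le_trans by blast
    qed
    finally show ?thesis using A by simp
  qed
  have "{r \<in> R. c {x, r} \<in> K} \<subseteq> B \<union> (Z \<inter> R) \<union> A \<union> {r \<in> V. r \<noteq> x \<and> c {x, r} \<in> U'} \<union> D"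
    using RV xy by (auto simp: B_def D_def)
  then have "card {r \<in> R. c {x, r} \<in> K} \<le>
      card (B \<union> (Z \<inter> R) \<union> A \<union> {r \<in> V. r \<noteq> x \<and> c {x, r} \<in> U'} \<union> D)"
    using finR finite_V A(3) by (intro card_mono) (auto simp: B_def D_def)
  also have "\<dots> \<le> card B + card (Z \<inter> R) + card A + card {r \<in> V. r \<noteq> x \<and> c {x, r} \<in> U'} + card D"
    by (meson card_Un_le add_le_mono le_trans order_refl)
  also have "\<dots> \<le> card B + 2 * q + s + (3 * q + s) + s * (3 * q)"
  proof -
    have "card {r \<in> V. r \<noteq> x \<and> c {x, r} \<in> U'} \<le> 3 * q + s"
      using card_colored_neighbours[OF _ fU', of x] xy cU' by auto
    then show ?thesis using Z A(2) cD by linarith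
  qed
  finally have "s * s * s + s \<le> card B" using deg(1) d by linarith
  moreover have "A \<subseteq> V" "B \<subseteq> V" "A \<inter> B = {}" using AR RV by (auto simp: B_def)
  ultimately obtain a b where ab: "a \<in> A" "b \<in> B" "c {a, b} \<in> K" 
    using expand A(2) unfolding expanding_def by blast
  have a: "a \<in> R - Z" "c {y, a} \<in> K - U" using ab A by (auto simp: A0_def)
  have b: "b \<in> R - Z" "c {b, x} \<in> K - U'" "c {a, b} \<notin> U" "a \<noteq> b"
    using ab by (auto simp: B_def insert_commute)
  have neq: "a \<in> V" "b \<in> V" "x \<noteq> a" "x \<noteq> b" "y \<noteq> a" "y \<noteq> b" using a b xy RV by auto
  have "c {y, a} \<noteq> c {b, x}" "c {b, x} \<notin> U" using b(2) ab(1) unfolding U'_def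
    by (metis DiffD2 UnI2 imageI) (use b(2) in \<open>simp add: U'_def\<close>)
  moreover have "c {y, a} \<noteq> c {a, b}"
    using proper[of a y b] neq b(4) xy by (auto simp: insert_commute)
  moreover have "c {a, b} \<noteq> c {b, x}"
    using proper[of b a x] neq b(4) xy by (auto simp: insert_commute)
  ultimately show ?thesis using that a b ab(3) by blast
qed

text \<open>In \<open>q - 1\<close> rounds an end of one path is joined to the start of another.
  Each round spends three colors of \<open>K\<close> and two vertices of \<open>R\<close>, so the
  budget of \<open>ex_rainbow_connection\<close> is never exceeded.\<close>

lemma connect_rainbow_forest:
  assumes RV: "R \<subseteq> V" and XV: "X \<subseteq> V" "X \<inter> R = {}"
    and deg: "\<And>v. v \<in> X \<Longrightarrow> d \<le> card {r \<in> R. c {v, r} \<in> K}"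
    and d: "s * s * s + 3 * s + 5 * q + s * (3 * q) \<le> d"
    and expand: "expanding s K"
    and WX: "W \<subseteq> X" and lf: "linear_forest W E" and cW: "card W = card E + q" and q: "0 < q"
    and inj: "inj_on col E" and nK: "col ` E \<inter> K = {}"
  obtains W' E' where "W' \<subseteq> V" "linear_forest W' E'" "card W' = Suc (card E')"
    "inj_on col E'" "card W \<le> card W'"
proof -
  \<comment> \<open>All ends of paths stay in \<open>X\<close>, where the degree bound into
    \<open>R\<close> is available.\<close>
  define state where "state = (\<lambda>i W' E'. W' \<subseteq> X \<union> R \<and> linear_forest W' E' \<and>
    card W' = card E' + (q - i) \<and> inj_on col E' \<and> card W \<le> card W' \<and>
    W' - Range E' \<subseteq> X \<and> W' - Domain E' \<subseteq> X \<and>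
    card (col ` E' \<inter> K) \<le> 3 * i \<and> card (W' \<inter> R) \<le> 2 * i)"
  have "\<exists>W' E'. state i W' E'" if "i < q" for i
    using that
  proof (induction i)
    case 0
    have "W \<inter> R = {}" using WX XV by auto
    then have "state 0 W E" using WX lf cW inj nK by (auto simp: state_def)
    then show ?case by blast
  next
    case (Suc i)
    then obtain W1 E1 where st: "state i W1 E1" by auto
    have lf1: "linear_forest W1 E1" and W1: "W1 \<subseteq> X \<union> R" and c1: "card W1 = card E1 + (q - i)"
      and inj1: "inj_on col E1" and ends: "W1 - Range E1 \<subseteq> X" "W1 - Domain E1 \<subseteq> X"
      and U1: "card (col ` E1 \<inter> K) \<le> 3 * i" and Z1: "card (W1 \<inter> R) \<le> 2 * i"
      and big: "card W \<le> card W1"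
      using st by (auto simp: state_def)
    have finW1: "finite W1" and EW1: "E1 \<subseteq> W1 \<times> W1" using lf1 by (auto simp: linear_forest_def)
    have finE1: "finite E1" using linear_forest_finite[OF lf1] .
    have "card (W1 - Range E1) = q - i" "card (W1 - Domain E1) = q - i"
      using linear_forest_card_ends[OF lf1] c1 by simp_all
    then have two: "card (W1 - Range E1) \<noteq> 0" "1 < card (W1 - Domain E1)" using Suc.prems by simp_all
    then obtain x where x: "x \<in> W1 - Range E1" by (metis card.empty ex_in_conv)
    \<comment> \<open>Only one end is reachable from \<open>x\<close>, so one of two distinct ends
      belongs to another path.\<close>
    obtain y1 y2 where y12: "y1 \<in> W1 - Domain E1" "y2 \<in> W1 - Domain E1" "y1 \<noteq> y2"
    proof -
      have "\<not> (\<exists>z. W1 - Domain E1 \<subseteq> {z})"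
        using two(2) card_mono[of "{_}" "W1 - Domain E1"] by fastforce
      then show ?thesis using that by blast
    qed
    obtain y where y: "y \<in> W1 - Domain E1" "(x, y) \<notin> E1\<^sup>*"
      using y12 linear_forest_ends_eq[OF lf1, of y1 y2 x] by blast
    have xX: "x \<in> X" "y \<in> X" using x y ends by auto
    have xV: "x \<in> V - R" "y \<in> V - R" using xX XV by auto
    have "finite (col ` E1 \<inter> K)" "card (col ` E1 \<inter> K) \<le> 3 * q" "card (W1 \<inter> R) \<le> 2 * q"
      using finE1 U1 Z1 Suc.prems by auto
    then obtain a b where ab: "a \<in> R - W1" "b \<in> R - W1" "a \<noteq> b"
        "c {y, a} \<in> K - (col ` E1 \<inter> K)" "c {a, b} \<in> K - (col ` E1 \<inter> K)" "c {b, x} \<in> K - (col ` E1 \<inter> K)"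
        "c {y, a} \<noteq> c {a, b}" "c {a, b} \<noteq> c {b, x}" "c {y, a} \<noteq> c {b, x}"
      using ex_rainbow_connection[OF RV _ _ _ xV deg[OF xX(1)] deg[OF xX(2)] d expand] by blast
    let ?W = "insert a (insert b W1)"
    let ?E = "insert (y, a) (insert (a, b) (insert (b, x) E1))"
    have "linear_forest ?W ?E"
      using lf1 x y ab by (intro linear_forest_connect) auto
    moreover have "?W \<subseteq> X \<union> R" using W1 ab by auto
    moreover have "card ?E = card E1 + 3"
    proof -
      have "(b, x) \<notin> E1" "(a, b) \<notin> insert (b, x) E1" "(y, a) \<notin> insert (a, b) (insert (b, x) E1)"
        using EW1 ab y x by auto
      then show ?thesis using finE1 by simp
    qed
    moreover have cW: "card ?W = card W1 + 2" using finW1 ab by simp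
    moreover have "card W1 + 2 = card E1 + 3 + (q - Suc i)" using c1 Suc.prems by simp
    moreover have "inj_on col ?E" using inj1 ab by auto
    moreover have "?W - Range ?E \<subseteq> X" "?W - Domain ?E \<subseteq> X" using ends by auto
    moreover have "card (col ` ?E \<inter> K) \<le> 3 * Suc i"
    proof -
      have "col ` ?E \<inter> K \<subseteq> insert (c {y, a}) (insert (c {a, b}) (insert (c {b, x}) (col ` E1 \<inter> K)))"
        by auto
      then have "card (col ` ?E \<inter> K) \<le>
          card (insert (c {y, a}) (insert (c {a, b}) (insert (c {b, x}) (col ` E1 \<inter> K))))"
        using finE1 by (intro card_mono) auto
      also have "\<dots> \<le> Suc (Suc (Suc (card (col ` E1 \<inter> K))))"
        using finE1 by (simp add: card_insert_if)
      finally show ?thesis using U1 by simp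
    qed
    moreover have "card (?W \<inter> R) \<le> 2 * Suc i"
    proof -
      have "card (?W \<inter> R) \<le> card (insert a (insert b (W1 \<inter> R)))"
        using finW1 by (intro card_mono) auto
      also have "\<dots> \<le> Suc (Suc (card (W1 \<inter> R)))"
        using finW1 by (simp add: card_insert_if)
      finally show ?thesis using Z1 by simp
    qed
    ultimately have "state (Suc i) ?W ?E" using big by (simp add: state_def)
    then show ?case by blast
  qed
  \<comment> \<open>After \<open>q - 1\<close> rounds the path count \<open>q - i\<close> equals
    1.\<close>
  then obtain W' E' where "state (q - 1) W' E'" using q by (metis diff_less zero_less_one)
  then show ?thesis using that[of W' E'] q RV XV by (auto simp: state_def)
qed

section \<open>Reserving a sparse color class and assembling one long path\<close>

text \<open>Averaging: the \<open>k\<close> classes share a total degree of at most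
  \<open>card V * card V\<close>.\<close>

lemma ex_sparse_color_class:
  assumes f: "\<And>e. f e < (k::nat)" and k: "0 < k"
  obtains j where "j < k" "k * (\<Sum>v\<in>V. card {w \<in> V. w \<noteq> v \<and> f (c {v, w}) = j}) \<le> card V * card V"
proof -
  let ?g = "\<lambda>j. \<Sum>v\<in>V. card {w \<in> V. w \<noteq> v \<and> f (c {v, w}) = j}"
  have "(\<Sum>j<k. ?g j) = (\<Sum>v\<in>V. \<Sum>j<k. card {w \<in> V. w \<noteq> v \<and> f (c {v, w}) = j})"
    by (rule sum.swap)
  also have "\<dots> \<le> (\<Sum>v\<in>V. card V)"
  proof (rule sum_mono)
    fix v
    have "(\<Sum>j<k. card {w \<in> V. w \<noteq> v \<and> f (c {v, w}) = j}) =
        card (\<Union>j<k. {w \<in> V. w \<noteq> v \<and> f (c {v, w}) = j})"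
      using finite_V by (intro card_UN_disjoint[symmetric]) auto
    also have "\<dots> \<le> card V" using finite_V by (intro card_mono) auto
    finally show "(\<Sum>j<k. card {w \<in> V. w \<noteq> v \<and> f (c {v, w}) = j}) \<le> card V" .
  qed
  finally have "k * (\<Sum>j<k. ?g j) \<le> k * (card V * card V)" by simp
  then have "\<not> (\<Sum>j<k. card V * card V) < (\<Sum>j<k. k * ?g j)" by (simp add: sum_distrib_left)
  then have "\<not> (\<forall>j\<in>{..<k}. card V * card V < k * ?g j)"
    using k sum_strict_mono[of "{..<k}" "\<lambda>_. card V * card V" "\<lambda>j. k * ?g j"] by auto
  then show ?thesis using that by (auto simp: not_less)
qed

text \<open>With \<open>M * M\<close> classes, \<open>card R = n div M\<close> and
  \<open>T = M\<close>, the losses, multiplied by \<open>M\<close>, are \<open>n\<close> for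
  \<open>R\<close>, \<open>M * s\<close> for \<open>bad1\<close>, \<open>n\<close> for
  \<open>bad2\<close>, \<open>n\<close> for the reserved colors and \<open>2 * n\<close> for the
  forest lemma.\<close>

lemma almost_spanning_rainbow_linear_path:
  defines "n \<equiv> card V"
  assumes M: "0 < M" and s: "0 < s" and qdef: "q = M * M + M"
    and ddef: "d = s * s * s + 3 * s + 5 * q + s * (3 * q)"
    and less: "M * M * n ^ (2 * s) * (M * M - 1) ^ (s * s) < (M * M) ^ (s * s)"
    and R_large: "s * d + s * s * s + s \<le> n div M"
    and n_large: "M * q + 2 * n + M * s \<le> M * n"
  obtains W E where "W \<subseteq> V" "linear_forest W E" "card W = Suc (card E)" "inj_on col E"
    "M * n \<le> M * card W + 5 * n + M * s"
proof -
  have MM: "0 < M * M" using M by simp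
  obtain f :: "nat \<Rightarrow> nat" where f: "\<forall>e. f e < M * M" "\<forall>j < M * M. expanding s {e. f e = j}"
    using ex_expanding_color_partition[OF s MM less[unfolded n_def]] .
  obtain j where j: "j < M * M"
      "M * M * (\<Sum>v\<in>V. card {w \<in> V. w \<noteq> v \<and> f (c {v, w}) = j}) \<le> n * n"
    using ex_sparse_color_class[OF spec[OF f(1)] MM, folded n_def] .
  define K where "K = {e. f e = j}"
  define deg where "deg = (\<lambda>v. card {w \<in> V. w \<noteq> v \<and> c {v, w} \<in> K})"
  have expand: "expanding s K" using f(2) j(1) by (simp add: K_def)
  have sum_deg: "M * M * (\<Sum>v\<in>V. deg v) \<le> n * n" using j(2) by (simp add: deg_def K_def)
  have n: "0 < n" using R_large s by (metis add_is_0 bot_nat_0.extremum_uniqueI div_0 not_gr_zero)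
  have "n div M \<le> card V" by (simp add: n_def)
  then obtain R where R: "R \<subseteq> V" "card R = n div M" "finite R"
    using obtain_subset_with_card_n by metis
  define bad1 where "bad1 = {v \<in> V - R. card {r \<in> R. c {v, r} \<in> K} < d}"
  define bad2 where "bad2 = {v \<in> V. n div M < deg v}"
  \<comment> \<open>A set of \<open>s\<close> such vertices has at most \<open>s * d\<close>
    neighbours in \<open>R\<close> through \<open>K\<close>; the rest of \<open>R\<close> is still
    large enough for expansion to apply.\<close>
  have cbad1: "card bad1 \<le> s"
  proof (rule ccontr)
    assume "\<not> card bad1 \<le> s"
    then obtain A where A: "A \<subseteq> bad1" "card A = s" "finite A"
      using obtain_subset_with_card_n nat_le_linear by metis
    define B where "B = R - (\<Union>v\<in>A. {r \<in> R. c {v, r} \<in> K})"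
    have "card (\<Union>v\<in>A. {r \<in> R. c {v, r} \<in> K}) \<le> (\<Sum>v\<in>A. card {r \<in> R. c {v, r} \<in> K})"
      using A(3) by (rule card_UN_le)
    also have "\<dots> \<le> of_nat (card A) * d"
      using A(1) by (intro sum_bounded_above) (auto simp: bad1_def)
    finally have "card (\<Union>v\<in>A. {r \<in> R. c {v, r} \<in> K}) \<le> s * d" using A by simp
    moreover have "card R - card (\<Union>v\<in>A. {r \<in> R. c {v, r} \<in> K}) \<le> card B"
      unfolding B_def using R A(3) by (intro diff_card_le_card_Diff) auto
    ultimately have "s * s * s + s \<le> card B" using R_large R(2) by linarith
    moreover have "A \<subseteq> V" "B \<subseteq> V" "A \<inter> B = {}" using A(1) R(1) by (auto simp: bad1_def B_def)
    ultimately obtain a b where "a \<in> A" "b \<in> B" "c {a, b} \<in> K"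
      using expand A(2) unfolding expanding_def by blast
    then show False by (auto simp: B_def)
  qed
  \<comment> \<open>Markov's inequality: degrees above \<open>n div M\<close> against a total of at
    most \<open>n * n\<close> divided by \<open>M * M\<close>. This is why the number of classes is
    a square.\<close>
  have cbad2: "M * card bad2 \<le> n"
  proof -
    have "card bad2 * Suc (n div M) \<le> (\<Sum>v\<in>bad2. deg v)"
      using sum_bounded_below[of bad2 "Suc (n div M)" deg] by (auto simp: bad2_def)
    also have "\<dots> \<le> (\<Sum>v\<in>V. deg v)"
      using finite_V by (intro sum_mono2) (auto simp: bad2_def)
    finally have "M * M * (card bad2 * Suc (n div M)) \<le> n * n"
      using sum_deg by (meson le_trans mult_le_mono2)
    moreover have "M * card bad2 * n \<le> M * card bad2 * (M * Suc (n div M))"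
      using M dividend_less_times_div[of M n] by (intro mult_le_mono2) simp
    moreover have "M * card bad2 * (M * Suc (n div M)) = M * M * (card bad2 * Suc (n div M))"
      by (simp only: mult_ac)
    ultimately have "M * card bad2 * n \<le> n * n" by linarith
    then show ?thesis using n by (simp only: mult_le_cancel2)
  qed
  define X where "X = V - R - bad1 - bad2"
  have "n \<le> card (X \<union> R \<union> bad1 \<union> bad2)"
    unfolding n_def using finite_V R by (intro card_mono) (auto simp: X_def bad1_def bad2_def)
  also have "\<dots> \<le> card X + card R + card bad1 + card bad2"
    by (meson card_Un_le add_le_mono le_trans order_refl)
  finally have "M * n \<le> M * (card X + card R + card bad1 + card bad2)" by simp
  also have "\<dots> \<le> M * card X + n + M * s + n"
  proof -
    have "M * card R \<le> n" using R(2) by simp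
    moreover have "M * card bad1 \<le> M * s" using cbad1 by simp
    ultimately show ?thesis using cbad2 unfolding distrib_left by linarith
  qed
  finally have cX: "M * n \<le> M * card X + 2 * n + M * s" by simp
  then have "M * q \<le> M * card X" using n_large by linarith
  then have qX: "M * M + M \<le> card X" using M qdef by simp
  have XV: "X \<subseteq> V" "X \<inter> R = {}" by (auto simp: X_def)
  have sparse: "card {w \<in> V. w \<noteq> v \<and> c {v, w} \<in> K} \<le> n div M" if "v \<in> X" for v
    using that by (auto simp: X_def bad2_def deg_def)
  obtain W E where WE: "W \<subseteq> X" "linear_forest W E" "card W = card E + q"
      "inj_on col E" "col ` E \<inter> K = {}" "M * card X \<le> M * (card W + n div M) + 2 * card X"
    using large_rainbow_forest[OF XV(1) sparse qX, folded qdef] .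
  have dX: "d \<le> card {r \<in> R. c {v, r} \<in> K}" if "v \<in> X" for v
    using that by (auto simp: X_def bad1_def)
  have d: "s * s * s + 3 * s + 5 * q + s * (3 * q) \<le> d" and q: "0 < q"
    using ddef qdef M by simp_all
  obtain W' E' where W': "W' \<subseteq> V" "linear_forest W' E'" "card W' = Suc (card E')"
      "inj_on col E'" "card W \<le> card W'"
    using connect_rainbow_forest[OF R(1) XV dX d expand WE(1-3) q WE(4,5)] .
  have "M * card X \<le> M * card W' + 3 * n"
  proof -
    have "card X \<le> n" unfolding n_def using XV finite_V by (simp add: card_mono)
    moreover have "M * (n div M) \<le> n" by simp
    moreover have "M * card W \<le> M * card W'" using W'(5) by simp
    moreover have "M * (card W + n div M) = M * card W + M * (n div M)" by (rule distrib_left)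
    ultimately show ?thesis using WE(6) by linarith
  qed
  then have "M * n \<le> M * card W' + 5 * n + M * s" using cX by linarith
  then show ?thesis using that W' by blast
qed

end

section \<open>Choice of parameters\<close>

text \<open>After division by \<open>k ^ (s * s)\<close> the left side is at most the
  \<open>s\<close>-th power of \<open>k * (s + 1) ^ 10 * r ^ s\<close> with
  \<open>r = 1 - 1 / k\<close>, and exponential decay beats the polynomial.\<close>

lemma eventually_few_bicliques:
  fixes k :: nat assumes k: "1 < k"
  shows "\<forall>\<^sub>F s in sequentially. \<forall>n < (s + 1) ^ 5. k * n ^ (2 * s) * (k - 1) ^ (s * s) < k ^ (s * s)"
proof -
  define r where "r = (real k - 1) / real k"
  have r: "0 < r" "r < 1" using k by (auto simp: r_def)
  have "((\<lambda>s::nat. real k * (real s + 1) ^ 10 * r ^ s) \<longlongrightarrow> 0) sequentially"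
    using r k by real_asymp
  then have "\<forall>\<^sub>F s::nat in sequentially. real k * (real s + 1) ^ 10 * r ^ s < 1"
    by (rule order_tendstoD) simp
  then show ?thesis using eventually_gt_at_top[of 0]
  proof eventually_elim
    fix s :: nat assume less: "real k * (real s + 1) ^ 10 * r ^ s < 1" and s: "0 < s"
    show "\<forall>n < (s + 1) ^ 5. k * n ^ (2 * s) * (k - 1) ^ (s * s) < k ^ (s * s)"
    proof (intro allI impI)
      fix n :: nat assume n: "n < (s + 1) ^ 5"
      have "real n \<le> (real s + 1) ^ 5"
        using n by (metis of_nat_Suc Suc_eq_plus1 less_imp_le of_nat_le_iff of_nat_power add.commute)
      then have "real n ^ 2 \<le> ((real s + 1) ^ 5) ^ 2" by (intro power_mono) auto
      then have n2: "real n ^ 2 \<le> (real s + 1) ^ 10" by (simp flip: power_mult)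
      \<comment> \<open>Enlarging the single factor \<open>k\<close> to \<open>k ^ s\<close> turns
        the whole product into an \<open>s\<close>-th power.\<close>
      have "real k * (real n ^ 2) ^ s * (r ^ s) ^ s \<le> real k ^ s * (real n ^ 2) ^ s * (r ^ s) ^ s"
        using k s r self_le_power[of "real k" s] by (intro mult_right_mono) auto
      also have "\<dots> = (real k * real n ^ 2 * r ^ s) ^ s" by (simp add: power_mult_distrib)
      also have "\<dots> < 1"
      proof -
        have "real k * real n ^ 2 * r ^ s \<le> real k * (real s + 1) ^ 10 * r ^ s"
          using n2 r by (intro mult_right_mono mult_left_mono) auto
        then show ?thesis using less s r by (intro power_less_one_iff[THEN iffD2]) auto
      qed
      finally have "real k * real n ^ (2 * s) * r ^ (s * s) < 1" by (simp add: power_mult)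
      then have "real k * real n ^ (2 * s) * (real k - 1) ^ (s * s) < real k ^ (s * s)"
        using k by (simp add: r_def power_divide field_simps)
      then have "real (k * n ^ (2 * s) * (k - 1) ^ (s * s)) < real (k ^ (s * s))"
        using k by (simp add: of_nat_diff)
      then show "k * n ^ (2 * s) * (k - 1) ^ (s * s) < k ^ (s * s)" by (simp only: of_nat_less_iff)
    qed
  qed
qed

section \<open>From complete graphs to the locale, and from forests back to vertex lists\<close>

lemma proper_edge_coloring_imp_clique:
  assumes "proper_edge_coloring (complete_graph_edges n) c"
  shows "properly_colored_clique {..<n} c"
proof
  fix a b b' assume *: "a \<in> {..<n}" "b \<in> {..<n}" "b' \<in> {..<n}" "a \<noteq> b" "a \<noteq> b'" "c {a, b} = c {a, b'}"
  then have "{a, b} \<in> complete_graph_edges n" "{a, b'} \<in> complete_graph_edges n"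
    by (auto simp: complete_graph_edges_def nsets_def)
  then have "{a, b} = {a, b'}"
    using assms *(6) unfolding proper_edge_coloring_def
    by (metis insert_disjoint(1) insertI1)
  then show "b = b'" by (metis doubleton_eq_iff)
qed simp

text \<open>Each undirected path edge comes from a directed edge of \<open>E\<close> with the same
  color, so injectivity of \<open>col\<close> on \<open>E\<close> carries over.\<close>

lemma linear_forest_rainbow_path:
  assumes clique: "properly_colored_clique {..<n} c"
    and W: "W \<subseteq> {..<n}" "linear_forest W E" "card W = Suc (card E)"
    and inj: "inj_on (properly_colored_clique.col c) E"
  obtains p where "is_path {..<n} (complete_graph_edges n) p" "rainbow c (path_edges p)"
    "length p = card W"
proof -
  interpret properly_colored_clique "{..<n}" c by (rule clique)
  obtain p where p: "p \<noteq> []" "distinct p" "set p = W"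
      "\<forall>i. Suc i < length p \<longrightarrow> (p ! i, p ! Suc i) \<in> E"
    using linear_forest_path[OF W(2,3)] by blast
  have e: "\<exists>a b. e = {a, b} \<and> (a, b) \<in> E \<and> a \<noteq> b \<and> a < n \<and> b < n" if "e \<in> path_edges p" for e
  proof -
    from that obtain i where i: "Suc i < length p" "e = {p ! i, p ! Suc i}"
      unfolding path_edges_def by blast
    then have "p ! i \<in> {..<n}" "p ! Suc i \<in> {..<n}"
      using p(3) W(1) nth_mem[of i p] nth_mem[of "Suc i" p] by auto
    moreover have "p ! i \<noteq> p ! Suc i" using p(2) i by (simp add: nth_eq_iff_index_eq)
    ultimately show ?thesis using i p(4) by auto
  qed
  show ?thesis
  proof (rule that[of p])
    have "path_edges p \<subseteq> complete_graph_edges n"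
    proof
      fix e assume "e \<in> path_edges p"
      then obtain a b where "e = {a, b}" "a \<noteq> b" "a < n" "b < n" using e by blast
      then show "e \<in> complete_graph_edges n" by (simp add: complete_graph_edges_def nsets_def)
    qed
    then show "is_path {..<n} (complete_graph_edges n) p"
      using p W(1) by (simp add: is_path_def)
    show "rainbow c (path_edges p)" unfolding rainbow_def
    proof (rule inj_onI)
      fix e e' assume *: "e \<in> path_edges p" "e' \<in> path_edges p" "c e = c e'"
      obtain a b where ab: "e = {a, b}" "(a, b) \<in> E" using e[OF *(1)] by blast
      obtain a' b' where ab': "e' = {a', b'}" "(a', b') \<in> E" using e[OF *(2)] by blast
      have "col (a, b) = col (a', b')" using * ab ab' by simp
      then have "(a, b) = (a', b')" using inj_onD[OF inj] ab ab' by blast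
      then show "e = e'" using ab ab' by simp
    qed
    show "length p = card W" using p distinct_card by metis
  qed
qed

section \<open>Fixing \<open>M\<close> and \<open>s\<close>, and conclusion\<close>

text \<open>The parameter \<open>s\<close> will be the integer fifth root of \<open>n\<close>: the
  reserved set must exceed a multiple of \<open>s ^ 4\<close>, since \<open>s * d\<close> has that
  order, while \<open>n\<close> must stay polynomial in \<open>s\<close>.\<close>

lemma ex_fifth_root: "\<exists>s::nat. s ^ 5 \<le> n \<and> n < (s + 1) ^ 5"
proof (induction n)
  case 0
  show ?case by (intro exI[of _ 0]) simp
next
  case (Suc n)
  then obtain s where s: "s ^ 5 \<le> n" "n < (s + 1) ^ 5" by blast
  show ?case
  proof (cases "Suc n < (s + 1) ^ 5")
    case True
    then show ?thesis using s by (intro exI[of _ s]) simp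
  next
    case False
    then have "Suc n = (s + 1) ^ 5" using s by simp
    moreover have "(s + 1) ^ 5 < (s + 1 + 1) ^ 5" by (rule power_strict_mono) auto
    ultimately show ?thesis by (metis order_refl)
  qed
qed

theorem almost_spanning_rainbow_path:
  fixes \<epsilon> :: real
  assumes "0 < \<epsilon>"
  shows "\<exists>n0. \<forall>n>n0. \<forall>c. proper_edge_coloring (complete_graph_edges n) c \<longrightarrow>
    (\<exists>p. is_path {..<n} (complete_graph_edges n) p \<and> rainbow c (path_edges p) \<and>
         real (length p) \<ge> (1 - \<epsilon>) * real n)"
proof -
  \<comment> \<open>The total loss is at most \<open>6 * n\<close> divided by \<open>M\<close>, as
    \<open>M * s \<le> n\<close>. The bound 4 covers
    \<open>M * q + 2 * n + M * s \<le> 4 * n\<close>.\<close>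
  obtain M :: nat where M: "6 / \<epsilon> < real M" "4 \<le> M"
  proof -
    obtain m :: nat where "6 / \<epsilon> < real m" using reals_Archimedean2 by blast
    then show ?thesis using that[of "max m 4"] by auto
  qed
  define q where "q = M * M + M"
  have "1 < M * M" using M(2) by (intro less_1_mult) auto
  then obtain s1 where s1: "\<And>s n. s1 \<le> s \<Longrightarrow> n < (s + 1) ^ 5 \<Longrightarrow>
      M * M * n ^ (2 * s) * (M * M - 1) ^ (s * s) < (M * M) ^ (s * s)"
    using eventually_few_bicliques[of "M * M"] unfolding eventually_sequentially by blast
  \<comment> \<open>One summand for each later demand on \<open>s\<close>: few bicliques, a large
    enough \<open>R\<close>, and \<open>q \<le> s\<close>.\<close>
  define s0 where "s0 = s1 + 14 * M + q"
  show ?thesis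
  proof (intro exI[of _ "(s0 + 1) ^ 5"] allI impI)
    fix n c assume n: "(s0 + 1) ^ 5 < n" and pc: "proper_edge_coloring (complete_graph_edges n) c"
    interpret properly_colored_clique "{..<n}" c
      by (rule proper_edge_coloring_imp_clique[OF pc])
    obtain s where s: "s ^ 5 \<le> n" "n < (s + 1) ^ 5" using ex_fifth_root by blast
    have "s0 \<le> s"
    proof (rule ccontr)
      assume "\<not> s0 \<le> s"
      then have "(s + 1) ^ 5 \<le> (s0 + 1) ^ 5" by (intro power_mono) auto
      then show False using s n by linarith
    qed
    then have le: "s1 \<le> s" "14 * M \<le> s" "q \<le> s" "1 \<le> s" using M(2) by (auto simp: s0_def)
    define d where "d = s * s * s + 3 * s + 5 * q + s * (3 * q)"
    have pow: "s \<le> s ^ 4" "s ^ 2 \<le> s ^ 4" "s ^ 3 \<le> s ^ 4" "s ^ 2 \<le> s ^ 5"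
      using le(4) by (auto intro: self_le_power power_increasing)
    \<comment> \<open>Once \<open>q\<close> is replaced by \<open>s\<close>, \<open>s * d\<close>
      contributes 1 + 8 + 3 multiples of \<open>s ^ 4\<close>, the other two terms one each.\<close>
    have "s * d + s * s * s + s \<le> 14 * s ^ 4"
    proof -
      have "s * d \<le> s * (s * s * s + 3 * s + 5 * s + s * (3 * s))"
        unfolding d_def using le(3) by (intro mult_left_mono add_mono) auto
      also have "\<dots> = s ^ 4 + 8 * s ^ 2 + 3 * s ^ 3" by (simp add: eval_nat_numeral algebra_simps)
      finally have "s * d \<le> s ^ 4 + 8 * s ^ 2 + 3 * s ^ 3" .
      moreover have "s * s * s = s ^ 3" by (simp add: eval_nat_numeral)
      ultimately show ?thesis using pow by linarith
    qed
    then have "M * (s * d + s * s * s + s) \<le> M * (14 * s ^ 4)" by (rule mult_le_mono2)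
    also have "\<dots> = (14 * M) * s ^ 4" by simp
    also have "\<dots> \<le> s * s ^ 4" using le(2) by (rule mult_le_mono1)
    also have "\<dots> \<le> n" using s(1) by (simp add: eval_nat_numeral)
    finally have large: "s * d + s * s * s + s \<le> n div M"
      using M(2) by (simp add: less_eq_div_iff_mult_less_eq mult.commute)
    have sn: "s * s \<le> n" using pow(4) s(1) by (simp add: power2_eq_square)
    have "M * s \<le> s * s" "M * q \<le> s * s" using le(2,3) by (intro mult_le_mono; simp)+
    then have Ms: "M * s \<le> n" "M * q \<le> n" using sn by linarith+
    have "4 * n \<le> M * n" using M(2) by (rule mult_le_mono1)
    then have large': "M * q + 2 * n + M * s \<le> M * n" using Ms by linarith
    obtain W E where W: "W \<subseteq> {..<n}" "linear_forest W E" "card W = Suc (card E)" "inj_on col E"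
        "M * n \<le> M * card W + 5 * n + M * s"
      using almost_spanning_rainbow_linear_path[of M s q d] M(2) le(4) q_def d_def s1[OF le(1) s(2)] large large'
      by auto
    obtain p where p: "is_path {..<n} (complete_graph_edges n) p" "rainbow c (path_edges p)"
        "length p = card W"
      using linear_forest_rainbow_path[OF properly_colored_clique_axioms W(1-4)] by blast
    have "M * n \<le> M * card W + 6 * n" using W(5) Ms by linarith
    then have "real (M * n) \<le> real (M * card W + 6 * n)" by (simp only: of_nat_le_iff)
    then have "real M * real n \<le> real M * real (card W) + 6 * real n" by simp
    also have "6 * real n \<le> (\<epsilon> * real M) * real n"
      using M(1) assms by (intro mult_right_mono) (auto simp: field_simps)
    finally have "real M * ((1 - \<epsilon>) * real n) \<le> real M * real (card W)" by (simp add: algebra_simps)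
    then have "(1 - \<epsilon>) * real n \<le> real (card W)" using M(2) by simp
    then show "\<exists>p. is_path {..<n} (complete_graph_edges n) p \<and> rainbow c (path_edges p) \<and>
        (1 - \<epsilon>) * real n \<le> real (length p)"
      using p by auto
  qed
qed

text \<open>Immediate from the stronger bound, because \<open>3/4 - \<epsilon>\<close> is below
  \<open>1 - \<epsilon>\<close>.\<close>

theorem theorem3:
  shows "\<forall>\<epsilon>::real. \<epsilon> > 0 \<longrightarrow> (\<exists>n0::nat. \<forall>n>n0. \<forall>c::nat set \<Rightarrow> nat.
    proper_edge_coloring (complete_graph_edges n) c \<longrightarrow>
      (\<exists>p. is_path {..<n} (complete_graph_edges n) p \<and> rainbow c (path_edges p) \<and>
           real (length p) \<ge> (3/4 - \<epsilon>) * real n))"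
proof (intro allI impI)
  fix \<epsilon> :: real assume "0 < \<epsilon>"
  then have *: "(3/4 - \<epsilon>) * real n \<le> (1 - \<epsilon>) * real n" for n
    by (intro mult_right_mono) auto
  obtain n0 where n0: "\<And>n c. n0 < n \<Longrightarrow> proper_edge_coloring (complete_graph_edges n) c \<Longrightarrow>
      \<exists>p. is_path {..<n} (complete_graph_edges n) p \<and> rainbow c (path_edges p) \<and>
        (1 - \<epsilon>) * real n \<le> real (length p)"
    using almost_spanning_rainbow_path[OF \<open>0 < \<epsilon>\<close>] by blast
  show "\<exists>n0::nat. \<forall>n>n0. \<forall>c::nat set \<Rightarrow> nat.
    proper_edge_coloring (complete_graph_edges n) c \<longrightarrow>
      (\<exists>p. is_path {..<n} (complete_graph_edges n) p \<and> rainbow c (path_edges p) \<and>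
           real (length p) \<ge> (3/4 - \<epsilon>) * real n)"
  proof (intro exI[of _ n0] allI impI)
    fix n c assume "n0 < n" "proper_edge_coloring (complete_graph_edges n) c"
    then obtain p where "is_path {..<n} (complete_graph_edges n) p" "rainbow c (path_edges p)"
        "(1 - \<epsilon>) * real n \<le> real (length p)"
      using n0 by blast
    then show "\<exists>p. is_path {..<n} (complete_graph_edges n) p \<and> rainbow c (path_edges p) \<and>
        (3/4 - \<epsilon>) * real n \<le> real (length p)"
      using order_trans[OF *[of n]] by blast
  qed
qed

end
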